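(* Let $f$ be a factor over binary variables $Y=\{y_1,\ldots,y_n\}$, i.e. a function $f:\{0,1\}^n\to\mathbb{R}$. Let $\gamma_1,\ldots,\gamma_n\in\mathbb{R}$ and let $g(y_1,\ldots,y_n)=\sum_{i=1}^n\gamma_i y_i$ be the factor defined as the sum of $n$ independent factors, one over each variable $y_i$. Let $h=f+g$. Then for every $j\in\{1,\ldots,n\}$ and all $\nu_1,\ldots,\nu_n\in\mathbb{R}$, $$\nu_{h\rightarrow y_j}(\nu_1,\ldots,\nu_n)=\nu_{f\rightarrow y_j}(\nu_1+\gamma_1,\ldots,\nu_n+\gamma_n)+\gamma_j.$$
   Context: A factor over binary variables $y_1,\ldots,y_n$ is a real-valued function on $\{0,1\}^n$. For any such factor $F$, any $j\in\{1,\ldots,n\}$, any $b\in\{0,1\}$ and real numbers $\nu_1,\ldots,\nu_n$, define $$\mu_{F\rightarrow y_j}(b,\nu_1,\ldots,\nu_n)=\min_{\substack{(y_1,\ldots,y_n)\in\{0,1\}^n\\ y_j=b}}\Big[F(y_1,\ldots,y_n)+\sum_{k\neq j}\nu_k y_k\Big],$$ that is, the minimum is over all assignments of the variables other than $y_j$, with $y_j$ fixed to $b$. Define also $$\nu_{F\rightarrow y_j}(\nu_1,\ldots,\nu_n)=\mu_{F\rightarrow y_j}(1,\nu_1,\ldots,\nu_n)-\mu_{F\rightarrow y_j}(0,\nu_1,\ldots,\nu_n).$$ These definitions are applied with $F=f$ and with $F=h$. *)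

theory Defs
  imports Complex_Main "HOL-Library.FuncSet"
begin

text \<open>
  Assignments of $y_1, \ldots, y_n$ are extensional functions on \<open>{1..n}\<close> with values 0 and 1.
  A factor is a function \<open>F :: (nat \<Rightarrow> nat) \<Rightarrow> real\<close>, of which only the values on
  \<open>assignments n\<close> matter.
\<close>

definition assignments :: "nat \<Rightarrow> (nat \<Rightarrow> nat) set" where
  "assignments n = {1..n} \<rightarrow>\<^sub>E {0, 1}"

definition msg_mu ::
  "nat \<Rightarrow> ((nat \<Rightarrow> nat) \<Rightarrow> real) \<Rightarrow> nat \<Rightarrow> nat \<Rightarrow> (nat \<Rightarrow> real) \<Rightarrow> real" where
  "msg_mu n F j b \<nu> =
    Min ((\<lambda>y. F y + (\<Sum>k\<in>{1..n} - {j}. \<nu> k * real (y k))) ` {y \<in> assignments n. y j = b})"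

definition msg_nu ::
  "nat \<Rightarrow> ((nat \<Rightarrow> nat) \<Rightarrow> real) \<Rightarrow> nat \<Rightarrow> (nat \<Rightarrow> real) \<Rightarrow> real" where
  "msg_nu n F j \<nu> = msg_mu n F j 1 \<nu> - msg_mu n F j 0 \<nu>"

text \<open>The minimum in \<open>msg_mu\<close> ranges over a finite nonempty set.\<close>

lemma finite_assignments: "finite (assignments n)"
  unfolding assignments_def by (intro finite_PiE) auto

lemma assignments_fixed_nonempty:
  assumes "j \<in> {1..n}" and "b \<in> {0, 1}"
  shows "{y \<in> assignments n. y j = b} \<noteq> {}"
proof -
  have "(\<lambda>i\<in>{1..n}. b) \<in> {y \<in> assignments n. y j = b}"
    using assms by (auto simp: assignments_def)
  then show ?thesis by blast
qed

end

theory Submission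
  imports Defs
begin

text \<open>Once \<open>y j = b\<close> is fixed, the part \<gamma>_j y_j of \<open>g\<close> is the
  constant \<gamma>_j b, while each other \<gamma>_k y_k merges with \<nu>_k y_k into the shifted
  message term. The constant passes through the minimum, which gives
  \<open>msg_mu_add_linear\<close>. In the difference of its instances \<open>b = 1\<close> and
  \<open>b = 0\<close>, the constants contribute exactly \<gamma>_j.\<close>

lemma msg_mu_add_linear:
  assumes g: "\<forall>y\<in>assignments n. g y = (\<Sum>i\<in>{1..n}. \<gamma> i * real (y i))"
    and h: "\<forall>y\<in>assignments n. h y = f y + g y"
    and j: "j \<in> {1..n}" and b: "b \<in> {0, 1}"
  shows "msg_mu n h j b \<nu> = msg_mu n f j b (\<lambda>i. \<nu> i + \<gamma> i) + \<gamma> j * real b"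
proof -
  let ?S = "{y \<in> assignments n. y j = b}"
  have "h y + (\<Sum>k\<in>{1..n} - {j}. \<nu> k * real (y k)) =
      f y + (\<Sum>k\<in>{1..n} - {j}. (\<nu> k + \<gamma> k) * real (y k)) + \<gamma> j * real b"
    if "y \<in> ?S" for y
  proof -
    \<comment> \<open>The index \<open>j\<close> is split off so that the rest of \<open>g\<close>
      runs over the same index set as the message sum and can be added to it termwise.\<close>
    have "g y = \<gamma> j * real b + (\<Sum>k\<in>{1..n} - {j}. \<gamma> k * real (y k))"
      using that g sum.remove[OF finite_atLeastAtMost j, of "\<lambda>i. \<gamma> i * real (y i)"] by auto
    with that h show ?thesis
      by (simp add: distrib_right sum.distrib)
  qed
  then have "msg_mu n h j b \<nu> =
      Min ((\<lambda>y. f y + (\<Sum>k\<in>{1..n} - {j}. (\<nu> k + \<gamma> k) * real (y k)) + \<gamma> j * real b) ` ?S)"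
    unfolding msg_mu_def by (intro arg_cong[where f = Min] image_cong) auto
  \<comment> \<open>A constant can be pulled out of \<open>Min\<close> only over a finite nonempty
    set; nonemptiness comes from \<open>j\<close> being a valid index and \<open>b\<close> a binary
    value.\<close>
  also have "\<dots> = msg_mu n f j b (\<lambda>i. \<nu> i + \<gamma> i) + \<gamma> j * real b"
    unfolding msg_mu_def
    using finite_assignments assignments_fixed_nonempty[OF j b] by (intro Min_add_commute) auto
  finally show ?thesis .
qed

theorem lemma2:
  fixes n :: nat
    and f g h :: "(nat \<Rightarrow> nat) \<Rightarrow> real"
    and \<gamma> :: "nat \<Rightarrow> real"
  assumes g: "\<forall>y\<in>assignments n. g y = (\<Sum>i\<in>{1..n}. \<gamma> i * real (y i))"
    and h: "\<forall>y\<in>assignments n. h y = f y + g y"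
  shows "\<forall>j\<in>{1..n}. \<forall>\<nu> :: nat \<Rightarrow> real.
    msg_nu n h j \<nu> = msg_nu n f j (\<lambda>i. \<nu> i + \<gamma> i) + \<gamma> j"
  using msg_mu_add_linear[OF g h] by (simp add: msg_nu_def)

end
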